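(* Let $K=K_1\times\cdots\times K_r$, where each $K_i\subseteq\mathbb{R}^{n_i}$ ($i\in I=\{1,\dots,r\}$) is a regular closed convex cone, let $n=\sum_{i=1}^r n_i$, and let $A=[A_1\ \cdots\ A_r]\in\mathbb{R}^{m\times n}$ with blocks $A_i\in\mathbb{R}^{m\times n_i}$. Consider the systems \[ \text{(P)}\quad Ax=0,\ x\in K,\qquad\qquad \text{(D)}\quad A^{\rm T}y\in K^*. \] For a unique partition $B\cup B'\cup N\cup N'\cup C\cup O=I$ of the index set $I$ the following three properties hold: (i) There exists a solution $\bar x$ to (P) such that $\bar x_i\in\operatorname{int}K_i$ for all $i\in B$ and $\bar x_i\neq 0$ for all $i\in B'\cup C$. (ii) There exists a solution $\bar y$ to (D) such that $A_i^{\rm T}\bar y\in\operatorname{int}K_i^*$ for all $i\in N$ and $A_i^{\rm T}\bar y\neq 0$ for all $i\in N'\cup C$. (iii) For any solutions $x$ to (P) and $y$ to (D) we have $x_i=0$ for all $i\in N'\cup N\cup O$ and $A_i^{\rm T}y=0$ for all $i\in B\cup B'\cup O$.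
   Context: A closed convex cone is regular if it is pointed (contains no line) and has nonempty interior. For a closed convex cone $K\subseteq\mathbb{R}^n$, $K^*=\{s\in\mathbb{R}^n\mid s^{\rm T}x\ge 0\ \forall x\in K\}$ is the dual cone; for $K=K_1\times\cdots\times K_r$ one has $K^*=K_1^*\times\cdots\times K_r^*$. A vector $x\in\mathbb{R}^n$ is written in blocks $x=(x_1,\dots,x_r)$ with $x_i\in\mathbb{R}^{n_i}$. $\operatorname{int}$ denotes interior. A partition of $I$ here means six labelled, pairwise disjoint, possibly empty subsets $B,B',N,N',C,O$ of $I$ whose union is $I$.
   Formalization: Properties (i)–(iii) alone do not separate B from B' or N from N' (e.g. A=0, K=R_+), so uniqueness is proved with the added condition that no solution is interior at an index of B' or N'; (i)–(iii) alone are shown to determine B∪B', N∪N', C and O. All n_i≥1. *)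

theory Defs
  imports "HOL-Analysis.Analysis"
begin

text \<open>
  The block structure of \<open>real ^ 'n\<close> is given by a surjection \<open>b :: 'n \<Rightarrow> 'r\<close> sending each coordinate
  to the label of its block; surjectivity says that every block has dimension at least one. The
  factor of label \<open>i\<close> is realised as the coordinate subspace \<open>block_space b i\<close> of \<open>real ^ 'n\<close>, and
  interiors and dual cones of subsets of that factor are taken inside this subspace. Blocks need
  not consist of consecutive coordinates.
\<close>

definition block_space :: "('n \<Rightarrow> 'r) \<Rightarrow> 'r \<Rightarrow> (real ^ 'n) set" where
  "block_space b i = {x. \<forall>j. b j \<noteq> i \<longrightarrow> x $ j = 0}"

definition block :: "('n \<Rightarrow> 'r) \<Rightarrow> 'r \<Rightarrow> real ^ 'n \<Rightarrow> real ^ 'n" where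
  "block b i x = (\<chi> j. if b j = i then x $ j else 0)"

definition interior_in :: "'a::euclidean_space set \<Rightarrow> 'a set \<Rightarrow> 'a set" where
  "interior_in V S = (top_of_set V) interior_of S"

definition dual_cone_in :: "'a::euclidean_space set \<Rightarrow> 'a set \<Rightarrow> 'a set" where
  "dual_cone_in V K = {s \<in> V. \<forall>x\<in>K. s \<bullet> x \<ge> 0}"

definition pointed :: "'a::euclidean_space set \<Rightarrow> bool" where
  "pointed K \<longleftrightarrow> \<not> (\<exists>a d. d \<noteq> 0 \<and> (\<forall>t::real. a + t *\<^sub>R d \<in> K))"

definition regular_cone_in :: "'a::euclidean_space set \<Rightarrow> 'a set \<Rightarrow> bool" where
  "regular_cone_in V K \<longleftrightarrow>
     K \<subseteq> V \<and> closed K \<and> convex_cone K \<and> pointed K \<and> interior_in V K \<noteq> {}"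

definition product_cone :: "('n \<Rightarrow> 'r) \<Rightarrow> ('r \<Rightarrow> (real ^ 'n) set) \<Rightarrow> (real ^ 'n) set" where
  "product_cone b K = {x. \<forall>i. block b i x \<in> K i}"

definition primal_solutions ::
    "real ^ 'n ^ 'm \<Rightarrow> ('n \<Rightarrow> 'r) \<Rightarrow> ('r \<Rightarrow> (real ^ 'n::finite) set) \<Rightarrow> (real ^ 'n) set" where
  "primal_solutions A b K = {x. A *v x = 0 \<and> x \<in> product_cone b K}"

definition dual_solutions ::
    "real ^ 'n ^ 'm \<Rightarrow> ('n \<Rightarrow> 'r) \<Rightarrow> ('r \<Rightarrow> (real ^ 'n::finite) set) \<Rightarrow> (real ^ 'm::finite) set" where
  "dual_solutions A b K = {y. transpose A *v y \<in> dual_cone_in UNIV (product_cone b K)}"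

definition six_partition ::
    "'r set \<Rightarrow> 'r set \<Rightarrow> 'r set \<Rightarrow> 'r set \<Rightarrow> 'r set \<Rightarrow> 'r set \<Rightarrow> 'r set \<Rightarrow> bool" where
  "six_partition I B B' N N' C Z \<longleftrightarrow>
     B \<union> B' \<union> N \<union> N' \<union> C \<union> Z = I \<and>
     B \<inter> B' = {} \<and> B \<inter> N = {} \<and> B \<inter> N' = {} \<and> B \<inter> C = {} \<and> B \<inter> Z = {} \<and>
     B' \<inter> N = {} \<and> B' \<inter> N' = {} \<and> B' \<inter> C = {} \<and> B' \<inter> Z = {} \<and>
     N \<inter> N' = {} \<and> N \<inter> C = {} \<and> N \<inter> Z = {} \<and>
     N' \<inter> C = {} \<and> N' \<inter> Z = {} \<and>
     C \<inter> Z = {}"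

text \<open>
  \<open>block b i (transpose A *v y)\<close> is \<open>transpose A\<^sub>i *v y\<close>, where \<open>A\<^sub>i\<close> consists of the columns of \<open>A\<close>
  in block \<open>i\<close>. The class written \<open>O\<close> in the literature is called \<open>Z\<close>, since \<open>O\<close> is the relation
  composition operator.
\<close>

definition complementarity_partition ::
    "real ^ 'n ^ 'm \<Rightarrow> ('n \<Rightarrow> 'r) \<Rightarrow> ('r \<Rightarrow> (real ^ 'n::finite) set) \<Rightarrow>
     'r set \<Rightarrow> 'r set \<Rightarrow> 'r set \<Rightarrow> 'r set \<Rightarrow> 'r set \<Rightarrow> 'r set \<Rightarrow> bool" where
  "complementarity_partition (A :: real ^ 'n ^ 'm::finite) b K B B' N N' C Z \<longleftrightarrow>
     six_partition UNIV B B' N N' C Z \<and>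
     (\<exists>x \<in> primal_solutions A b K.
        (\<forall>i\<in>B. block b i x \<in> interior_in (block_space b i) (K i)) \<and>
        (\<forall>i\<in>B' \<union> C. block b i x \<noteq> 0)) \<and>
     (\<exists>y \<in> dual_solutions A b K.
        (\<forall>i\<in>N. block b i (transpose A *v y)
                 \<in> interior_in (block_space b i) (dual_cone_in (block_space b i) (K i))) \<and>
        (\<forall>i\<in>N' \<union> C. block b i (transpose A *v y) \<noteq> 0)) \<and>
     (\<forall>x \<in> primal_solutions A b K. \<forall>y \<in> dual_solutions A b K.
        (\<forall>i\<in>N' \<union> N \<union> Z. block b i x = 0) \<and>
        (\<forall>i\<in>B \<union> B' \<union> Z. block b i (transpose A *v y) = 0))"

text \<open>
  The conditions of \<^const>\<open>complementarity_partition\<close> alone do not determine the partition: an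
  index of \<open>B\<close> may always be moved to \<open>B'\<close>, and an index of \<open>N\<close> to \<open>N'\<close>. For example, with
  \<open>A = 0\<close> and a single block, that block may be put in \<open>B\<close> or in \<open>B'\<close>. The following condition
  removes exactly this freedom: \<open>B'\<close> and \<open>N'\<close> contain only indices at which no solution is interior.
\<close>

definition boundary_only ::
    "real ^ 'n ^ 'm \<Rightarrow> ('n \<Rightarrow> 'r) \<Rightarrow> ('r \<Rightarrow> (real ^ 'n::finite) set) \<Rightarrow> 'r set \<Rightarrow> 'r set \<Rightarrow> bool"
  where
  "boundary_only (A :: real ^ 'n ^ 'm::finite) b K B' N' \<longleftrightarrow>
     (\<forall>x \<in> primal_solutions A b K.
        \<forall>i\<in>B'. block b i x \<notin> interior_in (block_space b i) (K i)) \<and>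
     (\<forall>y \<in> dual_solutions A b K.
        \<forall>i\<in>N'. block b i (transpose A *v y)
                  \<notin> interior_in (block_space b i) (dual_cone_in (block_space b i) (K i)))"

end

theory Submission
  imports Defs
begin

text \<open>
  A pair of solutions satisfies \<open>0 = (A x) \<bullet> y = (\<Sum>i. x\<^sub>i \<bullet> (A\<^sup>T y)\<^sub>i)\<close> with nonnegative summands, so
  every summand vanishes, and an interior block on one side forces the block on the other side to
  be zero. Both solution sets are closed under addition, and being interior or nonzero in a block
  survives the addition of a solution, because the cones and their duals contain no lines. Summing
  witnesses therefore yields one primal and one dual solution that are interior, or nonzero, in
  every block where this is possible at all. Those two solutions determine the partition.
\<close>

subsection \<open>Relative interiors of cones\<close>

lemma mem_interior_in:
  "x \<in> interior_in V S \<longleftrightarrow> x \<in> V \<and> (\<exists>e>0. \<forall>z\<in>V. dist z x < e \<longrightarrow> z \<in> S)"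
proof
  assume "x \<in> interior_in V S"
  then obtain T where T: "openin (top_of_set V) T" "x \<in> T" "T \<subseteq> S"
    unfolding interior_in_def interior_of_def by auto
  from T show "x \<in> V \<and> (\<exists>e>0. \<forall>z\<in>V. dist z x < e \<longrightarrow> z \<in> S)"
    unfolding openin_euclidean_subtopology_iff by blast
next
  assume "x \<in> V \<and> (\<exists>e>0. \<forall>z\<in>V. dist z x < e \<longrightarrow> z \<in> S)"
  then obtain e where e: "x \<in> V" "e > 0" "\<forall>z\<in>V. dist z x < e \<longrightarrow> z \<in> S" by blast
  have "openin (top_of_set V) (V \<inter> ball x e)" by (simp add: openin_open_Int)
  moreover have "x \<in> V \<inter> ball x e" "V \<inter> ball x e \<subseteq> S" using e by (auto simp: dist_commute)
  ultimately show "x \<in> interior_in V S"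
    unfolding interior_in_def interior_of_def by blast
qed

text \<open>The form in which interiority is used: from an interior point one can step a little both
  ways along any direction of \<open>V\<close> without leaving \<open>S\<close>.\<close>

lemma interior_in_move:
  assumes "subspace V" "x \<in> interior_in V S" "v \<in> V"
  obtains e where "e > 0" "x + e *\<^sub>R v \<in> S" "x - e *\<^sub>R v \<in> S"
proof -
  obtain d where d: "x \<in> V" "d > 0" "\<forall>z\<in>V. dist z x < d \<longrightarrow> z \<in> S"
    using assms(2) unfolding mem_interior_in by blast
  \<comment> \<open>The \<open>+ 1\<close> keeps the denominator positive when \<open>v = 0\<close>;
    both shifted points stay within \<open>d / 2\<close> of \<open>x\<close>.\<close>
  define e where "e = d / (2 * (norm v + 1))"
  have "e > 0" using d by (simp add: e_def add_nonneg_pos)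
  have "e * norm v < e * (norm v + 1)" using \<open>e > 0\<close> by simp
  also have "\<dots> = d / 2"
    unfolding e_def by (simp add: field_simps add_nonneg_eq_0_iff)
  finally have "e * norm v < d" using d by simp
  moreover have "x + e *\<^sub>R v \<in> V" "x - e *\<^sub>R v \<in> V"
    using assms(1,3) d(1) by (simp_all add: subspace_add subspace_diff subspace_scale)
  ultimately have "x + e *\<^sub>R v \<in> S" "x - e *\<^sub>R v \<in> S"
    using d(3) \<open>e > 0\<close> by (simp_all add: dist_norm)
  with \<open>e > 0\<close> that show ?thesis by blast
qed

text \<open>Translation by \<open>k\<close> carries a ball of \<open>V\<close> around
  \<open>x\<close> to one around \<open>x + k\<close>, and adding \<open>k\<close> to a point of
  \<open>K\<close> stays in \<open>K\<close>.\<close>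

lemma interior_in_add:
  assumes "subspace V" "K \<subseteq> V" "\<And>x y. \<lbrakk>x \<in> K; y \<in> K\<rbrakk> \<Longrightarrow> x + y \<in> K"
    and "x \<in> interior_in V K" "k \<in> K"
  shows "x + k \<in> interior_in V K"
proof -
  obtain d where d: "x \<in> V" "d > 0" "\<forall>z\<in>V. dist z x < d \<longrightarrow> z \<in> K"
    using assms(4) unfolding mem_interior_in by blast
  have "z \<in> K" if "z \<in> V" "dist z (x + k) < d" for z
  proof -
    have "z - k \<in> V" using assms(1,2,5) that(1) by (blast intro: subspace_diff)
    then have "z - k \<in> K" using d(3) that(2) by (simp add: dist_norm algebra_simps)
    then show ?thesis using assms(3)[of "z - k" k] assms(5) by simp
  qed
  moreover have "x + k \<in> V" using assms d by (blast intro: subspace_add)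
  ultimately show ?thesis using d(2) unfolding mem_interior_in by blast
qed

text \<open>Otherwise a small positive multiple of a nonzero vector of \<open>V\<close> and its
  negative would both lie in \<open>K\<close>.\<close>

lemma zero_notin_interior_in:
  assumes "subspace V" "V \<noteq> {0}"
    and salient: "\<And>x. \<lbrakk>x \<in> K; - x \<in> K\<rbrakk> \<Longrightarrow> x = 0"
  shows "0 \<notin> interior_in V K"
proof
  assume "0 \<in> interior_in V K"
  obtain v where "v \<in> V" "v \<noteq> 0" using assms(1,2) subspace_0 by fastforce
  then show False
    using interior_in_move[OF assms(1) \<open>0 \<in> interior_in V K\<close>, of v] salient
    by (metis add_0 diff_0 less_irrefl scaleR_eq_0_iff)
qed

text \<open>If \<open>x\<close> were nonzero, the nonnegative multiples of \<open>x\<close> and of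
  \<open>- x\<close> would together form a line in \<open>K\<close>.\<close>

lemma pointed_convex_cone_salient:
  assumes "convex_cone K" "pointed K" "x \<in> K" "- x \<in> K"
  shows "x = 0"
proof (rule ccontr)
  assume "x \<noteq> 0"
  have "0 + t *\<^sub>R x \<in> K" for t :: real
  proof (cases "t \<ge> 0")
    case True
    then show ?thesis using assms(1,3) by (simp add: convex_cone_scaleR)
  next
    case False
    then have "(- t) *\<^sub>R (- x) \<in> K" using assms(1,4) by (intro convex_cone_scaleR) auto
    then show ?thesis by simp
  qed
  then show False using assms(2) \<open>x \<noteq> 0\<close> unfolding pointed_def by blast
qed

text \<open>Stepping from \<open>x\<close> along \<open>- s\<close> stays in \<open>K\<close> but
  makes the inner product with \<open>s\<close> negative unless \<open>s = 0\<close>. Since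
  \<open>s\<close> is only assumed nonnegative on \<open>K\<close>, the lemma also applies with a
  dual cone as \<open>K\<close> and a point of the original cone as \<open>s\<close>.\<close>

lemma orthogonal_to_interior_in:
  assumes "subspace V" "x \<in> interior_in V K" "s \<in> V"
    and "\<And>z. z \<in> K \<Longrightarrow> z \<bullet> s \<ge> 0" "x \<bullet> s = 0"
  shows "s = 0"
proof -
  obtain e where "e > 0" "x - e *\<^sub>R s \<in> K" using interior_in_move[OF assms(1-3)] by blast
  then have "e * (s \<bullet> s) \<le> 0" using assms(4)[of "x - e *\<^sub>R s"] assms(5) by (simp add: inner_diff_left)
  then have "s \<bullet> s \<le> 0" using \<open>e > 0\<close> by (simp add: mult_le_0_iff)
  then show ?thesis by (metis inner_eq_zero_iff inner_ge_zero order_antisym)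
qed

text \<open>Both signs being nonnegative on \<open>K\<close>, \<open>s\<close> vanishes on all of
  \<open>K\<close>, in particular at an interior point. So solidity of \<open>K\<close> gives
  pointedness of its dual.\<close>

lemma dual_cone_in_salient:
  assumes "subspace V" "interior_in V K \<noteq> {}"
    and "s \<in> dual_cone_in V K" "- s \<in> dual_cone_in V K"
  shows "s = 0"
proof -
  obtain x where x: "x \<in> interior_in V K" using assms(2) by blast
  have orth: "z \<bullet> s = 0" if "z \<in> K" for z
    using assms(3,4) that by (force simp: dual_cone_in_def inner_commute)
  have "x \<in> K" using x unfolding mem_interior_in by force
  then show ?thesis
    using orthogonal_to_interior_in[OF assms(1) x, of s] orth assms(3) by (simp add: dual_cone_in_def)
qed

lemma dual_cone_in_add:
  assumes "subspace V" "s \<in> dual_cone_in V K" "t \<in> dual_cone_in V K"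
  shows "s + t \<in> dual_cone_in V K"
  using assms by (simp add: dual_cone_in_def subspace_add inner_add_left)

subsection \<open>Blocks\<close>

lemma subspace_block_space: "subspace (block_space b i)"
  by (auto simp: block_space_def subspace_def)

lemma block_in_block_space: "block b i x \<in> block_space b i"
  by (simp add: block_def block_space_def)

lemma block_add: "block b i (x + y) = block b i x + block b i y"
  by (simp add: block_def vec_eq_iff)

lemma block_zero: "block b i 0 = 0"
  by (simp add: block_def vec_eq_iff)

lemma block_block_space: "x \<in> block_space b i \<Longrightarrow> block b j x = (if j = i then x else 0)"
  by (auto simp: block_def block_space_def vec_eq_iff)

text \<open>Surjectivity of \<open>b\<close> enters here; it ensures that an interior block is
  nonzero.\<close>

lemma block_space_nontrivial:
  assumes "surj b"
  shows "block_space b i \<noteq> {0}"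
proof -
  obtain j where j: "b j = i" using assms by (metis surjD)
  have "axis j 1 \<in> block_space b i" using j by (auto simp: block_space_def axis_def)
  moreover have "axis j (1::real) \<noteq> 0" by (simp add: axis_eq_0_iff)
  ultimately show ?thesis by blast
qed

lemma inner_block_space: "x \<in> block_space b i \<Longrightarrow> s \<bullet> x = block b i s \<bullet> x"
  by (auto simp: block_def block_space_def inner_vec_def intro!: sum.cong)

text \<open>Every coordinate lies in exactly one block, so after swapping the sums each inner sum
  has a single nonzero term at most.\<close>

lemma inner_sum_blocks:
  fixes b :: "'n::finite \<Rightarrow> 'r::finite"
  shows "x \<bullet> s = (\<Sum>i\<in>UNIV. block b i x \<bullet> block b i s)"
proof -
  have "(\<Sum>i\<in>UNIV. block b i x \<bullet> block b i s) =
      (\<Sum>j\<in>UNIV. \<Sum>i\<in>UNIV. if b j = i then x $ j * s $ j else 0)"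
    unfolding inner_vec_def block_def by (subst sum.swap) (auto intro!: sum.cong)
  then show ?thesis by (simp add: inner_vec_def)
qed

text \<open>One inclusion of the product formula for dual cones: a vector of \<open>K i\<close>,
  already zero in the other blocks, belongs to the product cone because the other cones contain 0,
  so \<open>s\<close> can be tested on it.\<close>

lemma block_dual_product_cone:
  fixes b :: "'n::finite \<Rightarrow> 'r::finite"
  assumes "\<And>i. K i \<subseteq> block_space b i" "\<And>i. 0 \<in> K i"
    and "s \<in> dual_cone_in UNIV (product_cone b K)"
  shows "block b i s \<in> dual_cone_in (block_space b i) (K i)"
proof -
  have "block b i s \<bullet> x \<ge> 0" if "x \<in> K i" for x
  proof -
    have "x \<in> block_space b i" using that assms(1) by blast
    moreover from this have "x \<in> product_cone b K"
      using that assms(2) by (auto simp: product_cone_def block_block_space)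
    ultimately show ?thesis using assms(3) inner_block_space by (fastforce simp: dual_cone_in_def)
  qed
  then show ?thesis by (simp add: dual_cone_in_def block_in_block_space)
qed

subsection \<open>Combining solutions\<close>

text \<open>Induction over the finitely many indices: adding a witness for a new index keeps the
  properties already gained.\<close>

lemma common_witness:
  fixes Q :: "'r::finite \<Rightarrow> 'a::comm_monoid_add \<Rightarrow> bool"
  assumes "0 \<in> S" "\<And>x y. \<lbrakk>x \<in> S; y \<in> S\<rbrakk> \<Longrightarrow> x + y \<in> S"
    and stable: "\<And>i x y. \<lbrakk>x \<in> S; y \<in> S; Q i x\<rbrakk> \<Longrightarrow> Q i (x + y)"
  shows "\<exists>x\<in>S. \<forall>i. (\<exists>z\<in>S. Q i z) \<longrightarrow> Q i x"
proof -
  have "\<exists>x\<in>S. \<forall>i\<in>F. (\<exists>z\<in>S. Q i z) \<longrightarrow> Q i x" if "finite F" for F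
    using that
  proof induction
    case empty
    then show ?case using assms(1) by blast
  next
    case (insert j F)
    then obtain x where x: "x \<in> S" "\<forall>i\<in>F. (\<exists>z\<in>S. Q i z) \<longrightarrow> Q i x" by blast
    show ?case
    proof (cases "\<exists>z\<in>S. Q j z")
      case True
      then obtain z where z: "z \<in> S" "Q j z" by blast
      \<comment> \<open>\<open>stable\<close> preserves properties of the left summand, so it is
        applied to \<open>z + x\<close>.\<close>
      have "Q j (x + z)" using stable[OF z(1) x(1) z(2)] by (simp add: add.commute)
      then show ?thesis using x z assms(2) stable by (intro bexI[of _ "x + z"]) auto
    next
      case False
      then show ?thesis using x by blast
    qed
  qed
  from this[of UNIV] show ?thesis by simp
qed

text \<open>One witness for the interior properties plus one for the nonzero properties serves both.
  Nonzero blocks survive addition because cancellation would put a nonzero vector and its negative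
  in \<open>L i\<close>. Here \<open>L\<close> stands for the cones or for their duals.\<close>

lemma common_interior_nonzero_witness:
  fixes b :: "'n::finite \<Rightarrow> 'r::finite" and S :: "(real ^ 'n) set"
  assumes S: "0 \<in> S" "\<And>x y. \<lbrakk>x \<in> S; y \<in> S\<rbrakk> \<Longrightarrow> x + y \<in> S"
    and mem: "\<And>i x. x \<in> S \<Longrightarrow> block b i x \<in> L i"
    and L: "\<And>i. L i \<subseteq> block_space b i" "\<And>i x y. \<lbrakk>x \<in> L i; y \<in> L i\<rbrakk> \<Longrightarrow> x + y \<in> L i"
    and salient: "\<And>i x. \<lbrakk>x \<in> L i; - x \<in> L i\<rbrakk> \<Longrightarrow> x = 0"
  shows "\<exists>x\<in>S. \<forall>i. ((\<exists>z\<in>S. block b i z \<in> interior_in (block_space b i) (L i)) \<longrightarrow>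
                      block b i x \<in> interior_in (block_space b i) (L i)) \<and>
                   ((\<exists>z\<in>S. block b i z \<noteq> 0) \<longrightarrow> block b i x \<noteq> 0)"
proof -
  have interior_stable: "block b i (x + y) \<in> interior_in (block_space b i) (L i)"
    if "x \<in> S" "y \<in> S" "block b i x \<in> interior_in (block_space b i) (L i)" for i x y
    using interior_in_add[OF subspace_block_space L(1) L(2) that(3)] mem that by (simp add: block_add)
  have nonzero_stable: "block b i (x + y) \<noteq> 0" if "x \<in> S" "y \<in> S" "block b i x \<noteq> 0" for i x y
  proof
    assume "block b i (x + y) = 0"
    then have "- block b i x = block b i y" by (simp add: block_add add_eq_0_iff)
    then show False using salient mem that by metis
  qed
  obtain x where x: "x \<in> S" "\<And>i. (\<exists>z\<in>S. block b i z \<in> interior_in (block_space b i) (L i)) \<Longrightarrow>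
                      block b i x \<in> interior_in (block_space b i) (L i)"
    using common_witness[OF S, of "\<lambda>i x. block b i x \<in> interior_in (block_space b i) (L i)"]
      interior_stable by blast
  obtain y where y: "y \<in> S" "\<And>i. (\<exists>z\<in>S. block b i z \<noteq> 0) \<Longrightarrow> block b i y \<noteq> 0"
    using common_witness[OF S, of "\<lambda>i x. block b i x \<noteq> 0"] nonzero_stable by blast
  have "block b i (x + y) \<noteq> 0" if "\<exists>z\<in>S. block b i z \<noteq> 0" for i
    using nonzero_stable[OF y(1) x(1) y(2)[OF that]] by (simp add: add.commute)
  then show ?thesis
    using x y S(2) interior_stable by (intro bexI[of _ "x + y"]) auto
qed

subsection \<open>The partition\<close>

theorem theorem2:
  fixes b :: "'n::finite \<Rightarrow> 'r::finite"
    and K :: "'r \<Rightarrow> (real ^ 'n) set"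
    and A :: "real ^ 'n ^ 'm::finite"
  assumes "surj b"
    and "\<And>i. regular_cone_in (block_space b i) (K i)"
  shows "(\<exists>!(B, B', N, N', C, Z).
            complementarity_partition A b K B B' N N' C Z \<and> boundary_only A b K B' N') \<and>
         (\<forall>B\<^sub>1 B\<^sub>1' N\<^sub>1 N\<^sub>1' C\<^sub>1 Z\<^sub>1 B\<^sub>2 B\<^sub>2' N\<^sub>2 N\<^sub>2' C\<^sub>2 Z\<^sub>2.
            complementarity_partition A b K B\<^sub>1 B\<^sub>1' N\<^sub>1 N\<^sub>1' C\<^sub>1 Z\<^sub>1 \<longrightarrow>
            complementarity_partition A b K B\<^sub>2 B\<^sub>2' N\<^sub>2 N\<^sub>2' C\<^sub>2 Z\<^sub>2 \<longrightarrow>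
            B\<^sub>1 \<union> B\<^sub>1' = B\<^sub>2 \<union> B\<^sub>2' \<and> N\<^sub>1 \<union> N\<^sub>1' = N\<^sub>2 \<union> N\<^sub>2' \<and> C\<^sub>1 = C\<^sub>2 \<and> Z\<^sub>1 = Z\<^sub>2)"
proof -
  let ?V = "block_space b"
  let ?D = "\<lambda>i. dual_cone_in (?V i) (K i)"
  define X where "X = primal_solutions A b K"
  define Y where "Y = dual_solutions A b K"
  \<comment> \<open>Passing from \<open>y\<close> to the slack vector
    \<open>transpose A *v y\<close> gives the dual side the same shape as the primal side.\<close>
  define S where "S = (\<lambda>y. transpose A *v y) ` Y"
  \<comment> \<open>Lower-case sets collect the labels where some solution is nonzero, upper-case
    sets those where some solution is interior; the partition is expressed through these four
    sets.\<close>
  define p where "p = {i. \<exists>x\<in>X. block b i x \<noteq> 0}"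
  define P where "P = {i. \<exists>x\<in>X. block b i x \<in> interior_in (?V i) (K i)}"
  define d where "d = {i. \<exists>s\<in>S. block b i s \<noteq> 0}"
  define D where "D = {i. \<exists>s\<in>S. block b i s \<in> interior_in (?V i) (?D i)}"

  \<comment> \<open>Properties of the cones and solution sets\<close>
  have cone: "K i \<subseteq> ?V i" "convex_cone (K i)" "pointed (K i)" "interior_in (?V i) (K i) \<noteq> {}" for i
    using assms(2)[of i] by (auto simp: regular_cone_in_def)
  have K0: "0 \<in> K i" for i using cone(2) by (simp add: convex_cone_contains_0)
  have K_add: "x + y \<in> K i" if "x \<in> K i" "y \<in> K i" for i x y
    using cone(2) that by (simp add: convex_cone_add)
  have K_salient: "x = 0" if "x \<in> K i" "- x \<in> K i" for i x
    using pointed_convex_cone_salient cone(2,3) that by blast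
  have D_salient: "x = 0" if "x \<in> ?D i" "- x \<in> ?D i" for i x
    using dual_cone_in_salient[OF subspace_block_space cone(4)] that by blast

  have XK: "block b i x \<in> K i" if "x \<in> X" for i x
    using that by (simp add: X_def primal_solutions_def product_cone_def)
  have SD: "block b i s \<in> ?D i" if "s \<in> S" for i s
    using that block_dual_product_cone[OF cone(1) K0] by (auto simp: S_def Y_def dual_solutions_def)
  have X0: "0 \<in> X" using K0
    by (simp add: X_def primal_solutions_def product_cone_def block_zero)
  have X_add: "x + y \<in> X" if "x \<in> X" "y \<in> X" for x y
    using that K_add
    by (simp add: X_def primal_solutions_def product_cone_def block_add matrix_vector_right_distrib)
  have S0: "0 \<in> S" unfolding S_def Y_def
    by (rule image_eqI[of _ _ 0]) (simp_all add: dual_solutions_def dual_cone_in_def)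
  have S_add: "s + t \<in> S" if st: "s \<in> S" "t \<in> S" for s t
  proof -
    obtain y z where "y \<in> Y" "s = transpose A *v y" "z \<in> Y" "t = transpose A *v z"
      using st unfolding S_def by blast
    moreover from this have "y + z \<in> Y"
      unfolding Y_def dual_solutions_def mem_Collect_eq matrix_vector_right_distrib
      by (intro dual_cone_in_add subspace_UNIV)
    ultimately show ?thesis unfolding S_def by (metis image_eqI matrix_vector_right_distrib)
  qed

  \<comment> \<open>Complementarity and its consequences\<close>
  have complementary: "block b i x \<bullet> block b i s = 0" if xs: "x \<in> X" "s \<in> S" for x s i
  proof -
    obtain y where y: "s = transpose A *v y" using xs unfolding S_def by blast
    have "x \<bullet> s = (A *v x) \<bullet> y" using dot_lmul_matrix[of y A x] by (simp add: y inner_commute)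
    also have "\<dots> = 0" using xs by (simp add: X_def primal_solutions_def)
    finally have "(\<Sum>i\<in>UNIV. block b i x \<bullet> block b i s) = 0"
      using inner_sum_blocks[of x s b] by simp
    moreover have "block b i x \<bullet> block b i s \<ge> 0" for i
      using XK SD xs by (force simp: dual_cone_in_def inner_commute)
    ultimately show ?thesis by (simp add: sum_nonneg_eq_0_iff)
  qed

  have Pd: "P \<inter> d = {}"
  proof -
    have "block b i s = 0" if "x \<in> X" "block b i x \<in> interior_in (?V i) (K i)" "s \<in> S" for i x s
      using orthogonal_to_interior_in[OF subspace_block_space that(2) block_in_block_space, of s]
        complementary SD that by (force simp: dual_cone_in_def inner_commute)
    then show ?thesis unfolding P_def d_def by blast
  qed
  \<comment> \<open>The roles are exchanged: a primal block is nonnegative on the dual cone by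
    definition of the latter.\<close>
  have Dp: "D \<inter> p = {}"
  proof -
    have "block b i x = 0" if "x \<in> X" "block b i s \<in> interior_in (?V i) (?D i)" "s \<in> S" for i x s
      using orthogonal_to_interior_in[OF subspace_block_space that(2) block_in_block_space, of x]
        complementary XK that by (force simp: dual_cone_in_def inner_commute)
    then show ?thesis unfolding D_def p_def by blast
  qed
  have K_interior_nz: "0 \<notin> interior_in (?V i) (K i)" for i
    by (rule zero_notin_interior_in[OF subspace_block_space block_space_nontrivial[OF assms(1)]])
      (rule K_salient)
  have D_interior_nz: "0 \<notin> interior_in (?V i) (?D i)" for i
    by (rule zero_notin_interior_in[OF subspace_block_space block_space_nontrivial[OF assms(1)]])
      (rule D_salient)
  have Pp: "P \<subseteq> p" using K_interior_nz unfolding P_def p_def by force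
  have Dd: "D \<subseteq> d" using D_interior_nz unfolding D_def d_def by force

  \<comment> \<open>The conditions in terms of the index sets\<close>
  have partition_iff: "complementarity_partition A b K B B' N N' C Z \<longleftrightarrow>
      six_partition UNIV B B' N N' C Z \<and>
      (\<exists>x\<in>X. (\<forall>i\<in>B. block b i x \<in> interior_in (?V i) (K i)) \<and> (\<forall>i\<in>B' \<union> C. block b i x \<noteq> 0)) \<and>
      (\<exists>s\<in>S. (\<forall>i\<in>N. block b i s \<in> interior_in (?V i) (?D i)) \<and> (\<forall>i\<in>N' \<union> C. block b i s \<noteq> 0)) \<and>
      (N' \<union> N \<union> Z) \<inter> p = {} \<and> (B \<union> B' \<union> Z) \<inter> d = {}" for B B' N N' C Z
  proof -
    \<comment> \<open>The condition on pairs splits because neither solution set is empty: both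
      systems have the zero solution.\<close>
    have separate: "(\<forall>x\<in>X. \<forall>y\<in>Y. F x \<and> G y) \<longleftrightarrow> (\<forall>x\<in>X. F x) \<and> (\<forall>y\<in>Y. G y)" for F G
      using X0 S0 unfolding S_def by blast
    have p_disjoint: "J \<inter> p = {} \<longleftrightarrow> (\<forall>x\<in>X. \<forall>i\<in>J. block b i x = 0)" for J
      unfolding p_def by blast
    have d_disjoint: "J \<inter> d = {} \<longleftrightarrow> (\<forall>y\<in>Y. \<forall>i\<in>J. block b i (transpose A *v y) = 0)" for J
      unfolding d_def S_def by blast
    have bex_S: "(\<exists>s\<in>S. Q s) \<longleftrightarrow> (\<exists>y\<in>Y. Q (transpose A *v y))" for Q
      unfolding S_def by blast
    show ?thesis
      unfolding complementarity_partition_def X_def[symmetric] Y_def[symmetric]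
        separate p_disjoint d_disjoint bex_S
      by (rule refl)
  qed
  have boundary_iff: "boundary_only A b K B' N' \<longleftrightarrow> B' \<inter> P = {} \<and> N' \<inter> D = {}" for B' N'
    unfolding boundary_only_def X_def[symmetric] Y_def[symmetric] P_def D_def S_def by blast

  have determined: "B \<union> B' = p - d \<and> N \<union> N' = d - p \<and> C = p \<inter> d \<and> Z = - (p \<union> d) \<and> B \<subseteq> P \<and> N \<subseteq> D"
    if "complementarity_partition A b K B B' N N' C Z" for B B' N N' C Z
  proof -
    note h = that[unfolded partition_iff]
    have BN: "B \<subseteq> P" "N \<subseteq> D" using h unfolding P_def D_def by blast+
    have nz: "B' \<union> C \<subseteq> p" "N' \<union> C \<subseteq> d" using h unfolding p_def d_def by blast+
    have cover: "B \<union> B' \<union> N \<union> N' \<union> C \<union> Z = UNIV" 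
      using h by (simp add: six_partition_def)
    have "(N' \<union> N \<union> Z) \<inter> p = {}" "(B \<union> B' \<union> Z) \<inter> d = {}" using h by simp_all
    then have sub: "B \<union> B' \<subseteq> p - d" "N \<union> N' \<subseteq> d - p" "C \<subseteq> p \<inter> d" "Z \<subseteq> - (p \<union> d)"
      using BN nz Pp Dd by blast+
    \<comment> \<open>The four classes lie inside four pairwise disjoint sets and cover all labels,
      so the inclusions are equalities.\<close>
    have four: "i \<in> B \<union> B' \<or> i \<in> N \<union> N' \<or> i \<in> C \<or> i \<in> Z" for i
      using cover UNIV_I[of i] by blast
    have "p - d \<subseteq> B \<union> B'" "d - p \<subseteq> N \<union> N'" "p \<inter> d \<subseteq> C" "- (p \<union> d) \<subseteq> Z"
      using sub four by fast+
    with sub BN show ?thesis by (intro conjI equalityI)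
  qed

  \<comment> \<open>Existence of the partition\<close>
  let ?part = "(P, p - d - P, D, d - p - D, p \<inter> d, - (p \<union> d))"
  have part: "complementarity_partition A b K P (p - d - P) D (d - p - D) (p \<inter> d) (- (p \<union> d))"
  proof -
    have "\<exists>x\<in>X. \<forall>i. (i \<in> P \<longrightarrow> block b i x \<in> interior_in (?V i) (K i)) \<and>
        (i \<in> p \<longrightarrow> block b i x \<noteq> 0)"
      unfolding P_def p_def mem_Collect_eq by (rule common_interior_nonzero_witness) fact+
    then obtain x where x: "x \<in> X" "\<forall>i\<in>P. block b i x \<in> interior_in (?V i) (K i)"
        "\<forall>i\<in>p. block b i x \<noteq> 0"
      by blast
    \<comment> \<open>These two facts supply the premises on \<open>L\<close> when the witness lemma
      is applied to the dual cones.\<close>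
    have D_sub: "?D i \<subseteq> ?V i" for i by (auto simp: dual_cone_in_def)
    have D_add: "s + t \<in> ?D i" if "s \<in> ?D i" "t \<in> ?D i" for s t i
      using subspace_block_space that by (rule dual_cone_in_add)
    have "\<exists>s\<in>S. \<forall>i. (i \<in> D \<longrightarrow> block b i s \<in> interior_in (?V i) (?D i)) \<and>
        (i \<in> d \<longrightarrow> block b i s \<noteq> 0)"
      unfolding D_def d_def mem_Collect_eq by (rule common_interior_nonzero_witness) fact+
    then obtain s where s: "s \<in> S" "\<forall>i\<in>D. block b i s \<in> interior_in (?V i) (?D i)"
        "\<forall>i\<in>d. block b i s \<noteq> 0"
      by blast
    have "six_partition UNIV P (p - d - P) D (d - p - D) (p \<inter> d) (- (p \<union> d))"
      unfolding six_partition_def using Pp Dd Pd Dp by blast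
    moreover have "((d - p - D) \<union> D \<union> - (p \<union> d)) \<inter> p = {}" "(P \<union> (p - d - P) \<union> - (p \<union> d)) \<inter> d = {}"
      using Pd Dp by blast+
    ultimately show ?thesis unfolding partition_iff using x s by blast
  qed
  have part_boundary: "boundary_only A b K (p - d - P) (d - p - D)"
    unfolding boundary_iff by blast

  \<comment> \<open>Uniqueness of the partition\<close>
  have part_unique: "(B, B', N, N', C, Z) = ?part"
    if "complementarity_partition A b K B B' N N' C Z" "boundary_only A b K B' N'"
    for B B' N N' C Z
  proof -
    have disj: "B \<inter> B' = {}" "N \<inter> N' = {}"
      using that(1) by (simp_all add: complementarity_partition_def six_partition_def)
    have det: "B \<union> B' = p - d" "N \<union> N' = d - p" "C = p \<inter> d" "Z = - (p \<union> d)" "B \<subseteq> P" "N \<subseteq> D"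
      using determined[OF that(1)] by simp_all
    have only: "B' \<inter> P = {}" "N' \<inter> D = {}" using that(2) by (simp_all add: boundary_iff)
    \<comment> \<open>\<open>P\<close> lies in \<open>p - d\<close>, hence in
      \<open>B \<union> B'\<close>, and \<open>B'\<close> misses it; the dual case is
      symmetric.\<close>
    have "B = P" using det(1,5) only(1) Pp Pd by blast
    moreover have "N = D" using det(2,6) only(2) Dd Dp by blast
    moreover have "B' = p - d - P" using det(1) disj(1) \<open>B = P\<close> by blast
    moreover have "N' = d - p - D" using det(2) disj(2) \<open>N = D\<close> by blast
    ultimately show ?thesis using det(3,4) by simp
  qed
  have "\<exists>!(B, B', N, N', C, Z).
      complementarity_partition A b K B B' N N' C Z \<and> boundary_only A b K B' N'"
    (is "\<exists>!q. ?Q q")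
  proof (rule ex1I)
    show "?Q ?part" unfolding prod.case by (rule conjI[OF part part_boundary])
  next
    fix q assume q: "?Q q"
    obtain B B' N N' C Z where q_eq: "q = (B, B', N, N', C, Z)" by (rule prod_cases6)
    show "q = ?part" using q part_unique unfolding q_eq prod.case by (elim conjE)
  qed
  moreover have "\<forall>B\<^sub>1 B\<^sub>1' N\<^sub>1 N\<^sub>1' C\<^sub>1 Z\<^sub>1 B\<^sub>2 B\<^sub>2' N\<^sub>2 N\<^sub>2' C\<^sub>2 Z\<^sub>2.
      complementarity_partition A b K B\<^sub>1 B\<^sub>1' N\<^sub>1 N\<^sub>1' C\<^sub>1 Z\<^sub>1 \<longrightarrow>
      complementarity_partition A b K B\<^sub>2 B\<^sub>2' N\<^sub>2 N\<^sub>2' C\<^sub>2 Z\<^sub>2 \<longrightarrow>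
      B\<^sub>1 \<union> B\<^sub>1' = B\<^sub>2 \<union> B\<^sub>2' \<and> N\<^sub>1 \<union> N\<^sub>1' = N\<^sub>2 \<union> N\<^sub>2' \<and> C\<^sub>1 = C\<^sub>2 \<and> Z\<^sub>1 = Z\<^sub>2"
    \<comment> \<open>Both partitions are rewritten through the same sets \<open>p\<close> and
      \<open>d\<close>, so their merged classes agree.\<close>
    by (intro allI impI, (drule determined)+) simp
  ultimately show ?thesis by (rule conjI)
qed

end
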